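(* Let $0\ne I\subsetneq k[\mathbf{P}^N]$ be a homogeneous ideal. Then $\gamma(I)\ge 1$, and for positive integers $m,r$ we have: (a) If $r\alpha(I)>\alpha(I^{(m)})$, then $I^r$ does not contain $I^{(m)}$. (b) If $m/r<\alpha(I)/\gamma(I)$, then, for all integers $t\gg 0$, $I^{rt}$ does not contain $I^{(mt)}$. In particular, $1\le\alpha(I)/\gamma(I)\le\rho(I)$.
   Context: $k$ is an arbitrary algebraically closed field, $N\ge 1$, and $k[\mathbf{P}^N]=k[x_0,\dots,x_N]$ is the polynomial ring with its standard grading. Symbolic powers: for a homogeneous ideal $0\ne I\subsetneq R=k[\mathbf{P}^N]$ and $m\ge 1$, $I^{(m)}$ is the contraction to $R$ of $I^mR_A$, where $R_A$ is the localization of $R$ at the multiplicative system $A$ equal to the complement of the union of the associated primes of $I$. Resurgence: $\rho(I)=\sup\{m/r : m,r\ge 1 \text{ integers},\ I^{(m)}\not\subseteq I^r\}$. $\alpha(J)$, for a nonzero homogeneous ideal $J$, is the least degree $t$ with $J_t\ne 0$. $\gamma(I)=\lim_{m\to\infty}\alpha(I^{(m)})/m$; this limit exists by subadditivity of $m\mapsto\alpha(I^{(m)})$. *)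

theory Defs
  imports
    Complex_Main
    "HOL-Library.Cardinality"
    "HOL-Library.Poly_Mapping"
    "HOL-Library.Extended_Real"
    "HOL-Computational_Algebra.Fraction_Field"
    "HOL-Computational_Algebra.Polynomial"
    "HOL-Algebra.Ideal_Product"
    "HOL-Algebra.Algebraic_Closure_Type"
begin

text \<open>
  Polynomials over \<open>'k\<close> in the variables \<open>x\<^sub>i\<close>, \<open>i :: 'n\<close>: a finitely supported map from
  exponent vectors to coefficients. The ring operations are those of
  \<^theory>\<open>HOL-Library.Poly_Mapping\<close>; it needs a linear order on \<open>'n\<close> to provide the
  \<^class>\<open>idom\<close> instance. The ring of polynomials in \<open>x\<^sub>0, \<dots>, x\<^sub>N\<close> is the case \<open>CARD('n) = N + 1\<close>.
\<close>

type_synonym ('n, 'k) mpoly = "('n \<Rightarrow>\<^sub>0 nat) \<Rightarrow>\<^sub>0 'k"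

text \<open>The ring structure on a whole type, used to access the ideal theory of HOL-Algebra.\<close>

abbreviation type_ring :: "'a::comm_ring_1 ring" where
  "type_ring \<equiv> ring_of_type_algebra"


subsection \<open>Ideal powers, associated primes, symbolic powers\<close>

definition ideal_power :: "'a::comm_ring_1 set \<Rightarrow> nat \<Rightarrow> 'a set" where
  "ideal_power I m = I [^]\<^bsub>ideals_set type_ring\<^esub> m"

text \<open>The associated primes of \<open>I\<close> are the primes of the form \<open>(I : f)\<close>.\<close>

definition associated_primes :: "'a::comm_ring_1 set \<Rightarrow> 'a set set" where
  "associated_primes I = {P. primeideal P type_ring \<and> (\<exists>f. P = {g. g * f \<in> I})}"

text \<open>
  The localization \<open>A\<^sup>-\<^sup>1R\<close> of an integral domain at a multiplicative set \<open>A\<close> with \<open>0 \<notin> A\<close>, as a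
  subring of the fraction field; \<open>R\<close> embeds by \<open>a \<mapsto> Fract a 1\<close>.
\<close>

definition localization :: "'a::idom set \<Rightarrow> 'a fract ring" where
  "localization A = type_ring\<lparr>carrier := {Fract a s | a s. s \<in> A}\<rparr>"

definition symbolic_power :: "'a::idom set \<Rightarrow> nat \<Rightarrow> 'a set" where
  "symbolic_power I m =
     {f. Fract f 1 \<in> Idl\<^bsub>localization (- \<Union>(associated_primes I))\<^esub>
                        ((\<lambda>g. Fract g 1) ` ideal_power I m)}"

text \<open>The value is an extended real, as the set is not assumed to be bounded.\<close>

definition resurgence :: "'a::idom set \<Rightarrow> ereal" where
  "resurgence I =
     Sup {ereal (real m / real r) | m r.
            m \<ge> 1 \<and> r \<ge> 1 \<and> \<not> symbolic_power I m \<subseteq> ideal_power I r}"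


subsection \<open>The standard grading\<close>

definition mon_degree :: "('n \<Rightarrow>\<^sub>0 nat) \<Rightarrow> nat" where
  "mon_degree e = (\<Sum>i\<in>Poly_Mapping.keys e. Poly_Mapping.lookup e i)"

definition homogeneous_of_degree :: "nat \<Rightarrow> ('n, 'k::zero) mpoly \<Rightarrow> bool" where
  "homogeneous_of_degree d f \<longleftrightarrow> (\<forall>e\<in>Poly_Mapping.keys f. mon_degree e = d)"

definition homogeneous_component ::
    "nat \<Rightarrow> ('n, 'k::comm_monoid_add) mpoly \<Rightarrow> ('n, 'k) mpoly" where
  "homogeneous_component d f =
     (\<Sum>e\<in>{e \<in> Poly_Mapping.keys f. mon_degree e = d}.
        Poly_Mapping.single e (Poly_Mapping.lookup f e))"

definition homogeneous_ideal :: "('n, 'k::comm_ring_1) mpoly set \<Rightarrow> bool" where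
  "homogeneous_ideal I \<longleftrightarrow>
     ideal I type_ring \<and> (\<forall>f\<in>I. \<forall>d. homogeneous_component d f \<in> I)"

definition alpha :: "('n, 'k::zero) mpoly set \<Rightarrow> nat" where
  "alpha J = (LEAST t. \<exists>f\<in>J. f \<noteq> 0 \<and> homogeneous_of_degree t f)"

definition gamma :: "('n::linorder, 'k::idom) mpoly set \<Rightarrow> real" where
  "gamma I = lim (\<lambda>m. real (alpha (symbolic_power I m)) / real m)"

end

theory Submission
  imports Defs
begin

text \<open>
  The heart of the matter is \<open>\<alpha>(I\<^sup>(\<^sup>m\<^sup>)) \<ge> m\<close>. Let \<open>P\<close> be an associated prime of \<open>I\<close> (one exists because
  the polynomial ring is Noetherian) and let \<open>f \<in> I\<^sup>(\<^sup>m\<^sup>)\<close>, so that \<open>s f \<in> I\<^sup>m\<close> for some \<open>s \<notin> P\<close>. In the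
  Taylor expansion \<open>g(x + y) = \<Sum>\<^sub>e g\<^sub>e(x) y\<^sup>e\<close> of an element \<open>g\<close> of \<open>I\<^sup>m\<close>, all \<open>g\<^sub>e\<close> with \<open>|e| < m\<close> lie
  in \<open>P\<close>; as \<open>s \<notin> P\<close> and \<open>P\<close> is prime, the same then holds for \<open>f\<close>. If \<open>f\<close> had degree \<open>d < m\<close>, its
  coefficients, which are the \<open>f\<^sub>e\<close> with \<open>|e| = d\<close>, would be constants in \<open>P\<close>, so \<open>f = 0\<close>.

  The rest is Fekete's lemma for the subadditive sequence \<open>m \<mapsto> \<alpha>(I\<^sup>(\<^sup>m\<^sup>))\<close>, together with the fact
  that \<open>I\<^sup>r\<close> contains no nonzero form of degree less than \<open>r \<alpha>(I)\<close>.
\<close>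

subsection \<open>Monomials\<close>

lemma lookup_single_times:
  fixes f :: "'a::cancel_comm_monoid_add \<Rightarrow>\<^sub>0 'b::semiring_0"
  shows "Poly_Mapping.lookup (Poly_Mapping.single k c * f) (k + l) = c * Poly_Mapping.lookup f l"
proof -
  have "Poly_Mapping.lookup (Poly_Mapping.single k c * f) (k + l)
      = (\<Sum>i. (c when k = i) * (\<Sum>q. Poly_Mapping.lookup f q when k + l = i + q))"
    by (simp add: lookup_mult lookup_single)
  also have "\<dots> = (\<Sum>i. c * Poly_Mapping.lookup f l when i = k)"
    by (rule Sum_any.cong) (auto simp: when_def)
  finally show ?thesis by simp
qed

lemma poly_mapping_sum_single:
  "(\<Sum>k\<in>Poly_Mapping.keys f. Poly_Mapping.single k (Poly_Mapping.lookup f k)) = f"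
  by (rule poly_mapping_eqI)
     (auto simp: lookup_sum lookup_single when_def in_keys_iff if_distrib sum.delta cong: if_cong)

lemma poly_mapping_times_eq_sum:
  fixes f g :: "'a::monoid_add \<Rightarrow>\<^sub>0 'b::semiring_0"
  shows "f * g = (\<Sum>a\<in>Poly_Mapping.keys f. \<Sum>b\<in>Poly_Mapping.keys g.
     Poly_Mapping.single (a + b) (Poly_Mapping.lookup f a * Poly_Mapping.lookup g b))"
proof -
  have "f * g = (\<Sum>a\<in>Poly_Mapping.keys f. Poly_Mapping.single a (Poly_Mapping.lookup f a)) *
      (\<Sum>b\<in>Poly_Mapping.keys g. Poly_Mapping.single b (Poly_Mapping.lookup g b))"
    by (simp add: poly_mapping_sum_single)
  also have "\<dots> = (\<Sum>a\<in>Poly_Mapping.keys f. \<Sum>b\<in>Poly_Mapping.keys g.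
     Poly_Mapping.single (a + b) (Poly_Mapping.lookup f a * Poly_Mapping.lookup g b))"
    by (simp add: sum_product mult_single)
  finally show ?thesis .
qed

lemma mon_degree_eq_sum_UNIV:
  "mon_degree (e :: 'n::finite \<Rightarrow>\<^sub>0 nat) = (\<Sum>i\<in>UNIV. Poly_Mapping.lookup e i)"
  unfolding mon_degree_def by (rule sum.mono_neutral_left) (auto simp: in_keys_iff)

lemma mon_degree_0 [simp]: "mon_degree 0 = 0"
  by (simp add: mon_degree_def)

lemma mon_degree_add: "mon_degree (a + b) = mon_degree a + mon_degree (b :: 'n::finite \<Rightarrow>\<^sub>0 nat)"
  by (simp add: mon_degree_eq_sum_UNIV lookup_add sum.distrib)

lemma mon_degree_single [simp]: "mon_degree (Poly_Mapping.single i n) = n"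
  by (simp add: mon_degree_def)

lemma mon_degree_eq_0_iff [simp]: "mon_degree e = 0 \<longleftrightarrow> e = 0"
  by (auto simp: mon_degree_def in_keys_iff poly_mapping_eq_iff fun_eq_iff)

lemma exponent_split:
  fixes a b :: "'n \<Rightarrow>\<^sub>0 nat"
  assumes "\<And>x. Poly_Mapping.lookup a x \<le> Poly_Mapping.lookup b x"
  shows "b = a + (b - a)"
  using assms by (intro poly_mapping_eqI) (simp add: lookup_add lookup_minus)

lemma exponent_induct [case_names zero add_single]:
  fixes a :: "'n::finite \<Rightarrow>\<^sub>0 nat"
  assumes "P 0" and step: "\<And>a i. P a \<Longrightarrow> P (Poly_Mapping.single i 1 + a)"
  shows "P a"
proof (induction "mon_degree a" arbitrary: a)
  case 0
  then show ?case using assms(1) by simp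
next
  case (Suc n)
  then have "a \<noteq> 0" by auto
  then obtain i where i: "Poly_Mapping.lookup a i \<noteq> 0"
    by (metis poly_mapping_eqI lookup_zero)
  have a: "a = Poly_Mapping.single i 1 + (a - Poly_Mapping.single i 1)"
    using i by (intro exponent_split) (auto simp: lookup_single when_def)
  have "mon_degree a = 1 + mon_degree (a - Poly_Mapping.single i 1)"
    by (subst a) (simp add: mon_degree_add)
  with Suc have "P (a - Poly_Mapping.single i 1)" by auto
  from step[OF this] a show ?case by metis
qed

section \<open>Dickson's lemma and well-foundedness of the monomial order\<close>

text \<open>A monotone subsequence exists. If it decreases, it reaches its minimum at some index and
  is constant from there on, so its tail is nondecreasing.\<close>

lemma nat_seq_incseq_subseq:
  fixes s :: "nat \<Rightarrow> nat"
  shows "\<exists>f. strict_mono f \<and> incseq (\<lambda>n. s (f n))"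
proof -
  obtain f where f: "strict_mono (f :: nat \<Rightarrow> nat)" "monoseq (\<lambda>n. s (f n))"
    using seq_monosub[of s] by blast
  show ?thesis
  proof (cases "incseq (\<lambda>n. s (f n))")
    case True
    with f show ?thesis by blast
  next
    case False
    with f have dec: "decseq (\<lambda>n. s (f n))" by (simp add: monoseq_iff)
    obtain n where n: "\<And>m. s (f n) \<le> s (f m)"
      using ex_has_least_nat[of "\<lambda>_. True" _ "\<lambda>m. s (f m)"] by auto
    have "s (f (n + m)) = s (f n)" for m
      using n[of "n + m"] decseqD[OF dec, of n "n + m"] by simp
    then have "incseq (\<lambda>m. s (f (n + m)))" by (simp add: incseq_def)
    moreover have "strict_mono (\<lambda>m. f (n + m))"
      using f(1) by (simp add: strict_mono_def)
    ultimately show ?thesis by blast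
  qed
qed

text \<open>As there are finitely many variables, passing to a subsequence for one variable at a
  time makes all exponents nondecreasing at once. The first two terms of the last subsequence then
  give the pair.\<close>

lemma dickson:
  fixes s :: "nat \<Rightarrow> ('n::finite \<Rightarrow>\<^sub>0 nat)"
  shows "\<exists>i j. i < j \<and> (\<forall>x. Poly_Mapping.lookup (s i) x \<le> Poly_Mapping.lookup (s j) x)"
proof -
  have "\<exists>f. strict_mono f \<and> (\<forall>x\<in>A. incseq (\<lambda>n. Poly_Mapping.lookup (s (f n)) x))"
    if "finite A" for A
    using that
  proof induction
    case empty
    show ?case by (auto intro!: exI[of _ id] simp: strict_mono_def)
  next
    case (insert y A)
    then obtain f where f: "strict_mono (f :: nat \<Rightarrow> nat)"
        "\<forall>x\<in>A. incseq (\<lambda>n. Poly_Mapping.lookup (s (f n)) x)" by blast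
    obtain g where g: "strict_mono (g :: nat \<Rightarrow> nat)"
        "incseq (\<lambda>n. Poly_Mapping.lookup (s (f (g n))) y)"
      using nat_seq_incseq_subseq[of "\<lambda>n. Poly_Mapping.lookup (s (f n)) y"] by blast
    have "incseq (\<lambda>n. Poly_Mapping.lookup (s (f (g n))) x)" if "x \<in> A" for x
      using f(2) g(1) that by (auto simp: incseq_def strict_mono_less_eq)
    with f(1) g show ?case
      by (intro exI[of _ "f \<circ> g"]) (auto simp: strict_mono_def)
  qed
  from this[of UNIV] obtain f where f: "strict_mono (f :: nat \<Rightarrow> nat)"
      "\<And>x. incseq (\<lambda>n. Poly_Mapping.lookup (s (f n)) x)" by auto
  have "f 0 < f 1" using f(1) by (simp add: strict_mono_def)
  with f(2) show ?thesis by (metis incseqD zero_le)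
qed

text \<open>The order is decided at the least index where two vectors differ. Between
  \<open>0\<close> and \<open>c \<noteq> 0\<close> this is the least key of \<open>c\<close>, where
  \<open>c\<close> is positive.\<close>

lemma exponent_nonneg: "0 \<le> (c :: 'n::linorder \<Rightarrow>\<^sub>0 nat)"
proof (cases "c = 0")
  case False
  then have ne: "Poly_Mapping.keys c \<noteq> {}" by simp
  define k where "k = Min (Poly_Mapping.keys c)"
  have "k \<in> Poly_Mapping.keys c" and "\<And>j. j < k \<Longrightarrow> j \<notin> Poly_Mapping.keys c"
    using ne by (auto simp: k_def)
  then have "less_fun (Poly_Mapping.lookup 0) (Poly_Mapping.lookup c)"
    by (intro less_funI exI[of _ k]) (auto simp: in_keys_iff)
  then show ?thesis by (simp add: less_eq_poly_mapping.rep_eq)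
qed simp

lemma exponent_le_of_pointwise:
  fixes a b :: "'n::linorder \<Rightarrow>\<^sub>0 nat"
  assumes "\<And>x. Poly_Mapping.lookup a x \<le> Poly_Mapping.lookup b x"
  shows "a \<le> b"
  using exponent_split[OF assms] exponent_nonneg[of "b - a"] add_left_mono[of 0 "b - a" a] by simp

text \<open>In an infinite descending sequence, Dickson's lemma finds an earlier monomial dividing a
  later one. Divisibility implies \<le>, against the descent.\<close>

lemma wf_exponent_less: "wf {(a, b :: 'n::{finite,linorder} \<Rightarrow>\<^sub>0 nat). a < b}"
proof (unfold wf_iff_no_infinite_down_chain, rule notI, elim exE)
  fix s :: "nat \<Rightarrow> ('n \<Rightarrow>\<^sub>0 nat)"
  assume "\<forall>i. (s (Suc i), s i) \<in> {(a, b). a < b}"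
  then have step: "s (Suc n) < s n" for n by simp
  have "s j < s i" if "i < j" for i j
    using that by (induction rule: less_Suc_induct) (use step in auto)
  moreover obtain i j where "i < j" "\<forall>x. Poly_Mapping.lookup (s i) x \<le> Poly_Mapping.lookup (s j) x"
    using dickson[of s] by blast
  ultimately show False using exponent_le_of_pointwise[of "s i" "s j"] by (metis leD)
qed

subsection \<open>Ideals and the ascending chain condition\<close>

lemma uminus_type_ring: "\<ominus>\<^bsub>type_ring\<^esub> a = - (a :: 'a::comm_ring_1)"
proof -
  interpret R: ring "type_ring :: 'a ring" by (rule ring_from_type_algebra)
  show ?thesis by (rule R.minus_equality) (auto simp: ring_of_type_algebra_def)
qed

lemma ideal_type_ring_iff:
  "ideal I (type_ring :: 'a::comm_ring_1 ring) \<longleftrightarrow>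
     0 \<in> I \<and> (\<forall>a\<in>I. \<forall>b\<in>I. a + b \<in> I) \<and> (\<forall>r. \<forall>a\<in>I. r * a \<in> I)"
proof
  assume "ideal I (type_ring :: 'a ring)"
  then interpret ideal I "type_ring :: 'a ring" .
  show "0 \<in> I \<and> (\<forall>a\<in>I. \<forall>b\<in>I. a + b \<in> I) \<and> (\<forall>r. \<forall>a\<in>I. r * a \<in> I)"
    using additive_subgroup.zero_closed[OF is_additive_subgroup]
      additive_subgroup.a_closed[OF is_additive_subgroup] I_l_closed
    by (auto simp: ring_of_type_algebra_def)
next
  assume *: "0 \<in> I \<and> (\<forall>a\<in>I. \<forall>b\<in>I. a + b \<in> I) \<and> (\<forall>r. \<forall>a\<in>I. r * a \<in> I)"
  interpret R: ring "type_ring :: 'a ring" by (rule ring_from_type_algebra)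
  have neg: "- a \<in> I" if "a \<in> I" for a using * that by (metis mult_minus1)
  show "ideal I (type_ring :: 'a ring)"
  proof (rule idealI)
    show "ring (type_ring :: 'a ring)" by (rule ring_from_type_algebra)
    show "subgroup I (add_monoid (type_ring :: 'a ring))"
    proof (rule R.add.subgroupI)
      show "\<ominus>\<^bsub>type_ring\<^esub> a \<in> I" if "a \<in> I" for a
        using neg[OF that] by (simp add: uminus_type_ring)
    qed (use * in \<open>auto simp: ring_of_type_algebra_def\<close>)
  qed (use * in \<open>simp_all add: ring_of_type_algebra_def, metis mult.commute\<close>)
qed

lemma ideal_mult:
  assumes "ideal I (type_ring :: 'a::comm_ring_1 ring)" "a \<in> I"
  shows "r * a \<in> I" "a * r \<in> I"
  using assms by (auto simp: ideal_type_ring_iff mult.commute[of a])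

lemma ideal_diff:
  assumes "ideal I (type_ring :: 'a::comm_ring_1 ring)" "a \<in> I" "b \<in> I"
  shows "a - b \<in> I"
proof -
  have "a + (-1) * b \<in> I" using assms unfolding ideal_type_ring_iff by blast
  then show ?thesis by simp
qed

text \<open>The monomial order is the lexicographic order of \<^theory>\<open>HOL-Library.Poly_Mapping\<close>.\<close>

lemma leading_term_reduction:
  fixes f g :: "('n::{finite,linorder}, 'k::field) mpoly"
  assumes "f \<noteq> 0" "g \<noteq> 0"
    and le: "\<And>x. Poly_Mapping.lookup (Max (Poly_Mapping.keys f)) x
                  \<le> Poly_Mapping.lookup (Max (Poly_Mapping.keys g)) x"
  shows "\<exists>q. g - q * f = 0 \<or> Max (Poly_Mapping.keys (g - q * f)) < Max (Poly_Mapping.keys g)"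
proof -
  define a where "a = Max (Poly_Mapping.keys f)"
  define b where "b = Max (Poly_Mapping.keys g)"
  \<comment> \<open>This quotient makes the two leading terms cancel at \<open>b\<close>.\<close>
  define c where "c = Poly_Mapping.lookup g b / Poly_Mapping.lookup f a"
  define h where "h = g - Poly_Mapping.single (b - a) c * f"
  have b: "b = (b - a) + a"
    using exponent_split[of a b] le by (simp add: a_def b_def add.commute)
  have "a \<in> Poly_Mapping.keys f" using assms(1) by (simp add: a_def)
  then have a0: "Poly_Mapping.lookup f a \<noteq> 0" by (simp add: in_keys_iff)
  have "Poly_Mapping.lookup (Poly_Mapping.single (b - a) c * f) b = c * Poly_Mapping.lookup f a"
    using lookup_single_times[of "b - a" c f a] b by simp
  then have "Poly_Mapping.lookup h b = 0" using a0 by (simp add: h_def lookup_minus c_def)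
  then have nb: "b \<notin> Poly_Mapping.keys h" by (simp add: in_keys_iff)
  \<comment> \<open>No monomial above \<open>b\<close> appears: the exponents of \<open>f\<close>
    are shifted by \<open>b - a\<close>, and the order is compatible with addition.\<close>
  have "e \<le> b" if e: "e \<in> Poly_Mapping.keys h" for e
  proof -
    from e have "e \<in> Poly_Mapping.keys g \<or> e \<in> Poly_Mapping.keys (Poly_Mapping.single (b - a) c * f)"
      unfolding h_def in_keys_iff lookup_minus by auto
    then show ?thesis
    proof
      assume "e \<in> Poly_Mapping.keys g"
      then show ?thesis by (simp add: b_def)
    next
      assume "e \<in> Poly_Mapping.keys (Poly_Mapping.single (b - a) c * f)"
      then obtain d where d: "d \<in> Poly_Mapping.keys f" "e = (b - a) + d"
        using keys_mult[of "Poly_Mapping.single (b - a) c" f] by (auto split: if_splits)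
      then have "d \<le> a" by (simp add: a_def)
      then have "(b - a) + d \<le> (b - a) + a" by (rule add_left_mono)
      then show ?thesis using d b by simp
    qed
  qed
  with nb have "h = 0 \<or> Max (Poly_Mapping.keys h) < b"
    by (metis Max_in finite_keys keys_eq_empty order_le_less)
  then show ?thesis by (auto simp: h_def b_def)
qed

text \<open>If all steps were strict, choose in each \<open>J (Suc i) - J i\<close> an element
  \<open>f i\<close> with minimal leading monomial. By Dickson's lemma the leading monomial of some
  \<open>f i\<close> divides that of a later \<open>f j\<close>. Subtracting a multiple of
  \<open>f i\<close> from \<open>f j\<close> then leaves an element of
  \<open>J (Suc j) - J j\<close> with a smaller leading monomial.\<close>

lemma mpoly_ideal_chain_stabilizes:
  fixes J :: "nat \<Rightarrow> ('n::{finite,linorder}, 'k::field) mpoly set"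
  assumes ideal: "\<And>i. ideal (J i) type_ring" and "incseq J"
  shows "\<exists>i. J (Suc i) = J i"
proof (rule ccontr)
  assume contr: "\<nexists>i. J (Suc i) = J i"
  define lm :: "('n, 'k) mpoly \<Rightarrow> _" where "lm f = Max (Poly_Mapping.keys f)" for f
  have "\<exists>f. f \<in> J (Suc i) - J i \<and> (\<forall>g \<in> J (Suc i) - J i. \<not> lm g < lm f)" for i
  proof -
    have "J i \<subseteq> J (Suc i)" using \<open>incseq J\<close> by (auto simp: incseq_Suc_iff)
    with contr obtain f0 where "f0 \<in> J (Suc i) - J i" by blast
    then have "lm f0 \<in> lm ` (J (Suc i) - J i)" by blast
    then obtain m where m: "m \<in> lm ` (J (Suc i) - J i)"
        "\<And>y. (y, m) \<in> {(a, b). a < b} \<Longrightarrow> y \<notin> lm ` (J (Suc i) - J i)"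
      by (rule wfE_min[OF wf_exponent_less]) blast
    from m(1) obtain f where f: "f \<in> J (Suc i) - J i" "m = lm f" by (rule imageE) blast
    have "\<not> lm g < lm f" if "g \<in> J (Suc i) - J i" for g
      using m(2)[of "lm g"] f(2) imageI[OF that, of lm] by auto
    with f(1) show ?thesis by blast
  qed
  then obtain f where f: "\<And>i. f i \<in> J (Suc i) - J i"
      and min: "\<And>i g. g \<in> J (Suc i) - J i \<Longrightarrow> \<not> lm g < lm (f i)" by metis
  have f0: "f i \<noteq> 0" for i using f[of i] ideal[of i] by (auto simp: ideal_type_ring_iff)
  obtain i j where "i < j" "\<forall>x. Poly_Mapping.lookup (lm (f i)) x \<le> Poly_Mapping.lookup (lm (f j)) x"
    using dickson[of "\<lambda>i. lm (f i)"] by blast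
  then obtain q where q: "f j - q * f i = 0 \<or> lm (f j - q * f i) < lm (f j)"
    using leading_term_reduction[OF f0 f0, of i j] by (auto simp: lm_def)
  \<comment> \<open>As \<open>i < j\<close>, the multiple of \<open>f i\<close> already lies in
    \<open>J j\<close>, so the subtraction does not change the class modulo
    \<open>J j\<close>.\<close>
  have "J (Suc i) \<subseteq> J j" using incseqD[OF \<open>incseq J\<close>, of "Suc i" j] \<open>i < j\<close> by simp
  then have "q * f i \<in> J j" using f[of i] ideal[of j] by (auto simp: ideal_type_ring_iff)
  moreover have "J j \<subseteq> J (Suc j)" using \<open>incseq J\<close> by (auto simp: incseq_Suc_iff)
  ultimately have "f j - q * f i \<in> J (Suc j)" using f[of j] ideal_diff[OF ideal] by blast
  moreover have "f j - q * f i \<notin> J j"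
  proof
    assume "f j - q * f i \<in> J j"
    then have "(f j - q * f i) + q * f i \<in> J j"
      using \<open>q * f i \<in> J j\<close> ideal[of j] unfolding ideal_type_ring_iff by blast
    then show False using f[of j] by simp
  qed
  ultimately have "f j - q * f i \<noteq> 0" and "\<not> lm (f j - q * f i) < lm (f j)"
    using ideal[of j] min by (auto simp: ideal_type_ring_iff)
  with q show False by blast
qed

section \<open>Existence of an associated prime\<close>

lemma ideal_quotient:
  assumes "ideal I (type_ring :: 'a::comm_ring_1 ring)"
  shows "ideal {g. g * f \<in> I} type_ring"
  using assms by (auto simp: ideal_type_ring_iff distrib_right mult.assoc)

text \<open>The chain condition provides a maximal ideal among the (I : f) with
  \<open>f \<notin> I\<close>, and such a maximal quotient is prime.\<close>

lemma associated_primes_nonempty: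
  fixes I :: "('n::{finite,linorder}, 'k::field) mpoly set"
  assumes I: "ideal I type_ring" and "I \<noteq> UNIV"
  shows "associated_primes I \<noteq> {}"
proof -
  define Q where "Q f = {g. g * f \<in> I}" for f
  have Q: "ideal (Q f) type_ring" for f unfolding Q_def by (rule ideal_quotient[OF I])
  have one: "1 \<notin> I"
  proof
    assume "1 \<in> I"
    then have "r * 1 \<in> I" for r using I unfolding ideal_type_ring_iff by blast
    with \<open>I \<noteq> UNIV\<close> show False by auto
  qed
  have "\<exists>f. f \<notin> I \<and> (\<forall>g. g \<notin> I \<longrightarrow> Q f \<subseteq> Q g \<longrightarrow> Q g = Q f)"
  proof (rule ccontr)
    assume "\<not> ?thesis"
    then have step: "\<exists>g. g \<notin> I \<and> Q f \<subset> Q g" if "f \<notin> I" for f using that by blast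
    obtain g where g: "\<And>f. f \<notin> I \<Longrightarrow> g f \<notin> I \<and> Q f \<subset> Q (g f)" using step by metis
    \<comment> \<open>Iterating the choice of a strictly larger quotient, starting from
      \<open>1\<close>, gives a strictly increasing chain of ideals.\<close>
    define F where "F n = (g ^^ n) 1" for n
    have F: "F n \<notin> I" for n using one g by (induction n) (auto simp: F_def)
    have lt: "Q (F n) \<subset> Q (F (Suc n))" for n using g[OF F[of n]] by (simp add: F_def)
    then show False
      using mpoly_ideal_chain_stabilizes[of "\<lambda>n. Q (F n)"] Q
      by (metis incseq_SucI psubset_imp_subset psubset_eq)
  qed
  then obtain f where f: "f \<notin> I" and max: "\<And>g. g \<notin> I \<Longrightarrow> Q f \<subseteq> Q g \<Longrightarrow> Q g = Q f" by blast
  have "primeideal (Q f) type_ring"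
  proof (rule primeidealI)
    show "ideal (Q f) type_ring" by (rule Q)
    show "cring (type_ring :: ('n, 'k) mpoly ring)" by (rule cring_from_type_algebra)
    show "carrier type_ring \<noteq> Q f" 
    proof
      assume "carrier type_ring = Q f"
      then have "1 \<in> Q f" by (metis UNIV_I ring_of_type_algebra_def partial_object.select_convs(1))
      with f show False by (simp add: Q_def)
    qed
    fix a b assume "a \<otimes>\<^bsub>type_ring\<^esub> b \<in> Q f"
    then have ab: "a * (b * f) \<in> I" by (simp add: Q_def ring_of_type_algebra_def mult.assoc)
    show "a \<in> Q f \<or> b \<in> Q f"
    proof (rule disjCI)
      assume "b \<notin> Q f"
      then have "b * f \<notin> I" by (simp add: Q_def)
      \<comment> \<open>Maximality turns this inclusion into equality, and \<open>a\<close> lies in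
        the quotient by \<open>b * f\<close>.\<close>
      moreover have "Q f \<subseteq> Q (b * f)"
        using I by (auto simp: Q_def ideal_type_ring_iff mult.left_commute[of _ b])
      ultimately have "Q (b * f) = Q f" by (rule max)
      with ab show "a \<in> Q f" by (auto simp: Q_def)
    qed
  qed
  then show ?thesis by (auto simp: associated_primes_def Q_def)
qed

subsection \<open>Ideal powers and symbolic powers\<close>

lemma ideal_power_0 [simp]: "ideal_power I 0 = UNIV"
  by (simp add: ideal_power_def nat_pow_def ideals_set_def ring_of_type_algebra_def)

lemma ideal_power_Suc: "ideal_power I (Suc m) = ideal_prod type_ring (ideal_power I m) I"
  by (simp add: ideal_power_def nat_pow_def ideals_set_def)

text \<open>Elements of a power of \<open>I\<close> are built by products and sums, so only these
  two operations have to be followed. The lemma is applied to three filtrations: by the cofactors of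
  a fixed element, by order of vanishing, and by degree.\<close>

lemma ideal_power_subset_filtration:
  fixes I :: "'a::comm_ring_1 set"
  assumes "F 0 = UNIV"
    and add: "\<And>n a b. a \<in> F n \<Longrightarrow> b \<in> F n \<Longrightarrow> a + b \<in> F n"
    and mult: "\<And>n a b. a \<in> F n \<Longrightarrow> b \<in> I \<Longrightarrow> a * b \<in> F (Suc n)"
  shows "ideal_power I m \<subseteq> F m"
proof (induction m)
  case (Suc m)
  have "f \<in> F (Suc m)" if "f \<in> ideal_prod type_ring (ideal_power I m) I" for f
    using that
  proof induction
    case (prod i j)
    then show ?case using mult Suc by (auto simp: ring_of_type_algebra_def)
  next
    case (sum a b)
    then show ?case using add by (auto simp: ring_of_type_algebra_def)
  qed
  then show ?case by (auto simp: ideal_power_Suc)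
qed (simp add: assms(1))

lemma ideal_power_times_mem:
  fixes I :: "'a::comm_ring_1 set"
  assumes "f \<in> ideal_power I m" "a \<in> I"
  shows "f * a \<in> ideal_power I (Suc m)"
  using ideal_prod.prod[OF assms, of type_ring]
  by (simp add: ideal_power_Suc ring_of_type_algebra_def)

lemma power_mem_ideal_power:
  fixes I :: "'a::comm_ring_1 set"
  assumes "f \<in> I"
  shows "f ^ m \<in> ideal_power I m"
  by (induction m) (auto simp: mult.commute[of f] intro: ideal_power_times_mem assms)

lemma ideal_ideal_power:
  assumes "ideal I (type_ring :: 'a::comm_ring_1 ring)"
  shows "ideal (ideal_power I m) type_ring"
proof (induction m)
  case 0
  then show ?case by (simp add: ideal_type_ring_iff)
next
  case (Suc m)
  then show ?case
    using ring.ideal_prod_is_ideal[OF ring_from_type_algebra Suc assms] by (simp add: ideal_power_Suc)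
qed

lemma ideal_power_mult:
  fixes I :: "'a::comm_ring_1 set"
  assumes I: "ideal I type_ring" and f: "f \<in> ideal_power I m" and g: "g \<in> ideal_power I n"
  shows "f * g \<in> ideal_power I (n + m)"
proof -
  have "ideal_power I n \<subseteq> {g. f * g \<in> ideal_power I (n + m)}"
  proof (rule ideal_power_subset_filtration)
    show "{g. f * g \<in> ideal_power I (0 + m)} = UNIV"
      using f ideal_ideal_power[OF I, of m] by (auto simp: ideal_type_ring_iff mult.commute[of f])
    fix k a b
    show "a + b \<in> {g. f * g \<in> ideal_power I (k + m)}"
      if "a \<in> {g. f * g \<in> ideal_power I (k + m)}" "b \<in> {g. f * g \<in> ideal_power I (k + m)}"
      using that ideal_ideal_power[OF I, of "k + m"] by (auto simp: ideal_type_ring_iff distrib_left)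
    show "a * b \<in> {g. f * g \<in> ideal_power I (Suc k + m)}"
      if "a \<in> {g. f * g \<in> ideal_power I (k + m)}" "b \<in> I"
      using that ideal_power_times_mem[of "f * a" I "k + m" b] by (simp add: mult.assoc)
  qed
  with g show ?thesis by blast
qed

section \<open>Localization and the elementwise form of symbolic powers\<close>

text \<open>Excluding \<open>0\<close> keeps all denominators nonzero; \<open>Fract a 0\<close> is
  the default value \<open>0\<close>.\<close>

locale multiplicative_set =
  fixes A :: "'a::idom set"
  assumes one_mem: "1 \<in> A" and mult_mem: "s \<in> A \<Longrightarrow> t \<in> A \<Longrightarrow> s * t \<in> A" and zero_not_mem: "0 \<notin> A"
begin

lemma nonzero: "s \<in> A \<Longrightarrow> s \<noteq> 0"
  using zero_not_mem by blast

lemma ring_localization: "ring (localization A)"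
proof -
  interpret R: ring "type_ring :: 'a fract ring" by (rule ring_from_type_algebra)
  have "subring {Fract a s | a s. s \<in> A} (type_ring :: 'a fract ring)"
  proof (rule R.subringI)
    show "{Fract a s | a s. s \<in> A} \<subseteq> carrier type_ring"
      by (simp add: ring_of_type_algebra_def)
    show "\<one>\<^bsub>type_ring\<^esub> \<in> {Fract a s | a s. s \<in> A}"
      using one_mem by (auto simp: ring_of_type_algebra_def One_fract_def)
    show "\<ominus>\<^bsub>type_ring\<^esub> h \<in> {Fract a s | a s. s \<in> A}" if "h \<in> {Fract a s | a s. s \<in> A}" for h
      using that by (auto simp: uminus_type_ring simp del: minus_fract) (metis minus_fract)
    fix h k assume "h \<in> {Fract a s | a s. s \<in> A}" "k \<in> {Fract a s | a s. s \<in> A}"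
    then obtain a s b t where *: "h = Fract a s" "k = Fract b t" "s \<in> A" "t \<in> A" by blast
    then show "h \<otimes>\<^bsub>type_ring\<^esub> k \<in> {Fract a s | a s. s \<in> A}"
      using mult_mem by (auto simp: ring_of_type_algebra_def)
    show "h \<oplus>\<^bsub>type_ring\<^esub> k \<in> {Fract a s | a s. s \<in> A}"
      using * mult_mem[of s t] nonzero by (auto simp: ring_of_type_algebra_def)
  qed
  then show ?thesis unfolding localization_def by (rule R.subring_is_ring)
qed

lemma ideal_localization:
  assumes I: "ideal I (type_ring :: 'a ring)"
  shows "ideal {Fract a s | a s. a \<in> I \<and> s \<in> A} (localization A)"
proof (rule idealI[OF ring_localization])
  interpret L: ring "localization A" by (rule ring_localization)
  note loc = localization_def ring_of_type_algebra_def
  note I' = I[unfolded ideal_type_ring_iff]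
  let ?J = "{Fract a s | a s. a \<in> I \<and> s \<in> A}"
  have neg: "- a \<in> I" if "a \<in> I" for a using I' that by (metis mult_minus1)
  show "subgroup ?J (add_monoid (localization A))"
  proof (rule L.add.subgroupI)
    show "?J \<subseteq> carrier (localization A)" by (auto simp: loc)
    show "?J \<noteq> {}" using I' one_mem by auto
    show "\<ominus>\<^bsub>localization A\<^esub> h \<in> ?J" if h: "h \<in> ?J" for h
    proof -
      from h obtain a s where *: "h = Fract a s" "a \<in> I" "s \<in> A" by blast
      have "\<ominus>\<^bsub>localization A\<^esub> h = Fract (- a) s"
      proof (rule L.minus_equality)
        show "Fract (- a) s \<oplus>\<^bsub>localization A\<^esub> h = \<zero>\<^bsub>localization A\<^esub>"
          by (simp add: loc * flip: minus_fract)
      qed (use * in \<open>auto simp: loc simp del: minus_fract\<close>)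
      with * neg show ?thesis by blast
    qed
    fix h k assume "h \<in> ?J" "k \<in> ?J"
    then obtain a s b t where *: "h = Fract a s" "k = Fract b t" "s \<in> A" "t \<in> A" "a \<in> I" "b \<in> I"
      by blast
    have "h \<oplus>\<^bsub>localization A\<^esub> k = Fract (a * t + b * s) (s * t)"
      using * nonzero by (simp add: loc)
    moreover have "a * t + b * s \<in> I" using * I' by (simp add: mult.commute[of a t] mult.commute[of b s])
    ultimately show "h \<oplus>\<^bsub>localization A\<^esub> k \<in> ?J" using * mult_mem by blast
  qed
  fix h k assume "h \<in> ?J" "k \<in> carrier (localization A)"
  then obtain a s b t where *: "h = Fract a s" "k = Fract b t" "s \<in> A" "t \<in> A" "a \<in> I"
    by (auto simp: loc)
  have "k \<otimes>\<^bsub>localization A\<^esub> h = Fract (b * a) (t * s)"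
      "h \<otimes>\<^bsub>localization A\<^esub> k = Fract (b * a) (t * s)"
    using * by (simp_all add: loc mult.commute)
  moreover have "b * a \<in> I" "t * s \<in> A" using * I' mult_mem by blast+
  ultimately show "k \<otimes>\<^bsub>localization A\<^esub> h \<in> ?J" "h \<otimes>\<^bsub>localization A\<^esub> k \<in> ?J" by blast+
qed

text \<open>The fractions with numerator in \<open>I\<close> form an ideal containing the extension,
  and f/1 = a/s means \<open>s * f = a\<close>. Conversely, f/1 is the product of 1/s and (s f)/1,
  so it lies in every ideal containing the image of \<open>I\<close>. This removes fractions from
  all later arguments.\<close>

lemma Fract_mem_extension_iff:
  assumes I: "ideal I (type_ring :: 'a ring)"
  shows "Fract f 1 \<in> Idl\<^bsub>localization A\<^esub> ((\<lambda>g. Fract g 1) ` I) \<longleftrightarrow> (\<exists>s\<in>A. s * f \<in> I)"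
proof
  assume "Fract f 1 \<in> Idl\<^bsub>localization A\<^esub> ((\<lambda>g. Fract g 1) ` I)"
  moreover have "Idl\<^bsub>localization A\<^esub> ((\<lambda>g. Fract g 1) ` I) \<subseteq> {Fract a s | a s. a \<in> I \<and> s \<in> A}"
    using one_mem by (intro ring.genideal_minimal ring_localization ideal_localization I) blast
  ultimately obtain a s where "Fract f 1 = Fract a s" "a \<in> I" "s \<in> A" by blast
  then show "\<exists>s\<in>A. s * f \<in> I" using nonzero by (auto simp: eq_fract mult.commute)
next
  assume "\<exists>s\<in>A. s * f \<in> I"
  then obtain s where s: "s \<in> A" "s * f \<in> I" by blast
  have "Fract f 1 = Fract 1 s * Fract (s * f) 1"
    using nonzero[OF s(1)] by (simp add: eq_fract mult.commute)
  moreover have "Fract 1 s * Fract (s * f) 1 \<in> J"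
    if J: "ideal J (localization A)" "(\<lambda>g. Fract g 1) ` I \<subseteq> J" for J
  proof -
    interpret J: ideal J "localization A" by fact
    have "Fract (s * f) 1 \<in> J" "Fract 1 s \<in> carrier (localization A)"
      using J s by (auto simp: localization_def)
    from J.I_l_closed[OF this] show ?thesis by (simp add: localization_def ring_of_type_algebra_def)
  qed
  ultimately show "Fract f 1 \<in> Idl\<^bsub>localization A\<^esub> ((\<lambda>g. Fract g 1) ` I)"
    by (auto simp: genideal_def)
qed

end

text \<open>Each prime that misses two elements misses their product. If there were no associated
  prime, the complement would be the whole ring and contain \<open>0\<close>; hence the
  assumption.\<close>

lemma multiplicative_set_associated_primes:
  fixes I :: "'a::idom set"
  assumes "associated_primes I \<noteq> {}"
  shows "multiplicative_set (- \<Union>(associated_primes I))"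
proof
  have prime: "primeideal P type_ring" if "P \<in> associated_primes I" for P
    using that by (simp add: associated_primes_def)
  have id: "ideal P type_ring" if "P \<in> associated_primes I" for P
    using prime[OF that] by (rule primeideal.axioms)
  show "1 \<in> - \<Union>(associated_primes I)"
  proof (rule ComplI, elim UnionE)
    fix P assume P: "P \<in> associated_primes I" "1 \<in> P"
    have "x \<in> P" for x using id[OF P(1)] P(2) unfolding ideal_type_ring_iff by (metis mult.right_neutral)
    then show False
      using primeideal.I_notcarr[OF prime[OF P(1)]] by (auto simp: ring_of_type_algebra_def)
  qed
  show "s * t \<in> - \<Union>(associated_primes I)"
    if "s \<in> - \<Union>(associated_primes I)" "t \<in> - \<Union>(associated_primes I)" for s t
    using that primeideal.I_prime[OF prime, of _ s t] by (auto simp: ring_of_type_algebra_def)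
  show "0 \<notin> - \<Union>(associated_primes I)"
    using assms id by (auto simp: ideal_type_ring_iff)
qed

lemma mem_symbolic_power_iff:
  assumes "ideal I (type_ring :: 'a::idom ring)" "associated_primes I \<noteq> {}"
  shows "f \<in> symbolic_power I m \<longleftrightarrow> (\<exists>s\<in>- \<Union>(associated_primes I). s * f \<in> ideal_power I m)"
  unfolding symbolic_power_def
  using multiplicative_set.Fract_mem_extension_iff[OF multiplicative_set_associated_primes ideal_ideal_power]
    assms by blast

text \<open>The product of the two denominators serves for the product. This is the source of
  subadditivity of the initial degrees.\<close>

lemma symbolic_power_mult:
  assumes I: "ideal I (type_ring :: 'a::idom ring)" "associated_primes I \<noteq> {}"
    and "f \<in> symbolic_power I m" "g \<in> symbolic_power I n"
  shows "f * g \<in> symbolic_power I (m + n)"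
proof -
  obtain s t where *: "s \<in> - \<Union>(associated_primes I)" "s * f \<in> ideal_power I m"
      "t \<in> - \<Union>(associated_primes I)" "t * g \<in> ideal_power I n"
    using assms mem_symbolic_power_iff[OF I] by blast
  have "(t * g) * (s * f) \<in> ideal_power I (m + n)"
    by (rule ideal_power_mult[OF I(1) *(4) *(2)])
  then have "(s * t) * (f * g) \<in> ideal_power I (m + n)" by (simp add: ac_simps)
  moreover have "s * t \<in> - \<Union>(associated_primes I)"
    using multiplicative_set.mult_mem[OF multiplicative_set_associated_primes[OF I(2)]] * by blast
  ultimately show ?thesis using mem_symbolic_power_iff[OF I] by blast
qed

lemma ideal_power_subset_symbolic_power:
  assumes I: "ideal I (type_ring :: 'a::idom ring)" "associated_primes I \<noteq> {}"
  shows "ideal_power I m \<subseteq> symbolic_power I m"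
  using mem_symbolic_power_iff[OF I]
    multiplicative_set.one_mem[OF multiplicative_set_associated_primes[OF I(2)]]
  by (metis mult_1 subsetI)

subsection \<open>Taylor expansion\<close>

text \<open>
  \<open>shift f\<close> is \<open>f(x + y)\<close> as a polynomial in \<open>y\<close> over the ring of polynomials in \<open>x\<close>.
\<close>

definition shift_monomial ::
    "('n::finite \<Rightarrow>\<^sub>0 nat) \<Rightarrow> ('n, ('n, 'k::comm_ring_1) mpoly) mpoly" where
  "shift_monomial e = (\<Prod>i\<in>UNIV.
     (Poly_Mapping.single 0 (Poly_Mapping.single (Poly_Mapping.single i 1) 1)
        + Poly_Mapping.single (Poly_Mapping.single i 1) 1) ^ Poly_Mapping.lookup e i)"

definition shift :: "('n::finite, 'k::comm_ring_1) mpoly \<Rightarrow> ('n, ('n, 'k) mpoly) mpoly" where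
  "shift f = (\<Sum>e\<in>Poly_Mapping.keys f.
     Poly_Mapping.single 0 (Poly_Mapping.single 0 (Poly_Mapping.lookup f e)) * shift_monomial e)"

lemma shift_monomial_0 [simp]: "shift_monomial 0 = 1"
  by (simp add: shift_monomial_def)

lemma shift_monomial_add: "shift_monomial (a + b) = shift_monomial a * shift_monomial b"
  by (simp add: shift_monomial_def lookup_add power_add prod.distrib)

lemma shift_monomial_variable:
  "shift_monomial (Poly_Mapping.single i 1) =
     Poly_Mapping.single 0 (Poly_Mapping.single (Poly_Mapping.single i 1) 1)
       + Poly_Mapping.single (Poly_Mapping.single i 1) 1"
proof -
  have "shift_monomial (Poly_Mapping.single i 1) = (\<Prod>j\<in>UNIV. if j = i then
     Poly_Mapping.single 0 (Poly_Mapping.single (Poly_Mapping.single i 1) 1)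
       + Poly_Mapping.single (Poly_Mapping.single i 1) 1 else 1)"
    unfolding shift_monomial_def by (rule prod.cong) (auto simp: lookup_single when_def)
  then show ?thesis by simp
qed

lemma lookup_single_0_times:
  "Poly_Mapping.lookup (Poly_Mapping.single 0 c * h) e = c * Poly_Mapping.lookup h e"
  for h :: "'a::cancel_comm_monoid_add \<Rightarrow>\<^sub>0 'b::semiring_0"
  using lookup_single_times[of 0 c h e] by simp

text \<open>The case split is forced by truncated subtraction: if the variable \<open>i\<close> does
  not occur in \<open>e\<close>, then \<open>e - single i 1\<close> is \<open>e\<close>
  again.\<close>

lemma lookup_variable_times:
  "Poly_Mapping.lookup (Poly_Mapping.single (Poly_Mapping.single i 1) 1 * h) e =
     (if Poly_Mapping.lookup e i = 0 then 0 else Poly_Mapping.lookup h (e - Poly_Mapping.single i 1))"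
  for h :: "('n, 'b::semiring_1) mpoly"
proof (cases "Poly_Mapping.lookup e i = 0")
  case True
  have "e \<notin> Poly_Mapping.keys (Poly_Mapping.single (Poly_Mapping.single i 1) 1 * h)"
  proof
    assume "e \<in> Poly_Mapping.keys (Poly_Mapping.single (Poly_Mapping.single i 1) 1 * h)"
    then obtain d where "e = Poly_Mapping.single i 1 + d"
      using keys_mult[of "Poly_Mapping.single (Poly_Mapping.single i 1) 1" h] by auto
    with True show False by (simp add: lookup_add)
  qed
  with True show ?thesis by (simp add: in_keys_iff)
next
  case False
  then have "e = Poly_Mapping.single i 1 + (e - Poly_Mapping.single i 1)"
    by (intro exponent_split) (auto simp: lookup_single when_def)
  with False show ?thesis
    using lookup_single_times[of "Poly_Mapping.single i 1" 1 h "e - Poly_Mapping.single i 1"] by simp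
qed

lemma lookup_shift_monomial_0:
  "Poly_Mapping.lookup (shift_monomial a :: ('n::finite, ('n, 'k::comm_ring_1) mpoly) mpoly) 0
     = Poly_Mapping.single a 1"
proof (induction a rule: exponent_induct)
  case zero
  show ?case by (simp flip: single_one)
next
  case (add_single a i)
  show ?case
    by (subst shift_monomial_add, subst shift_monomial_variable)
       (simp only: distrib_right lookup_add lookup_single_0_times lookup_variable_times add_single,
        simp add: mult_single)
qed

text \<open>In (x + y)^a the total degree in y is at most |a|, and it is reached only by choosing
  the y-variable in every factor. The induction splits off one factor.\<close>

lemma lookup_shift_monomial_top:
  "mon_degree a \<le> mon_degree e \<Longrightarrow>
     Poly_Mapping.lookup (shift_monomial a :: ('n::finite, ('n, 'k::comm_ring_1) mpoly) mpoly) e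
       = (1 when e = a)"
proof (induction a arbitrary: e rule: exponent_induct)
  case zero
  show ?case by (simp add: lookup_one)
next
  case (add_single a i)
  have deg: "mon_degree a < mon_degree e" using add_single.prems by (simp add: mon_degree_add)
  then have "e \<noteq> a" by auto
  \<comment> \<open>The summand of the x-variable contributes nothing, since the remaining factors
    have degree in y below |e|.\<close>
  then have 1: "Poly_Mapping.lookup (shift_monomial a :: ('n, ('n, 'k) mpoly) mpoly) e = 0"
    using add_single.IH[of e] deg by simp
  have 2: "(if Poly_Mapping.lookup e i = 0 then 0 else
      Poly_Mapping.lookup (shift_monomial a :: ('n, ('n, 'k) mpoly) mpoly) (e - Poly_Mapping.single i 1))
      = (1 when e = Poly_Mapping.single i 1 + a)"
  proof (cases "Poly_Mapping.lookup e i = 0")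
    case True
    then have "e \<noteq> Poly_Mapping.single i 1 + a" by (auto simp: lookup_add)
    with True show ?thesis by simp
  next
    case False
    then have e: "e = Poly_Mapping.single i 1 + (e - Poly_Mapping.single i 1)"
      by (intro exponent_split) (auto simp: lookup_single when_def)
    have "mon_degree e = 1 + mon_degree (e - Poly_Mapping.single i 1)"
      by (subst e) (simp add: mon_degree_add)
    with deg have "mon_degree a \<le> mon_degree (e - Poly_Mapping.single i 1)" by simp
    moreover have "e - Poly_Mapping.single i 1 = a \<longleftrightarrow> e = Poly_Mapping.single i 1 + a"
      using e by (metis add_left_imp_eq)
    ultimately show ?thesis using False add_single.IH by simp
  qed
  show ?case
    by (subst shift_monomial_add, subst shift_monomial_variable)
       (simp only: distrib_right lookup_add lookup_single_0_times lookup_variable_times 1 2, simp)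
qed

text \<open>Additivity needs one index set for \<open>f\<close>, \<open>g\<close> and
  \<open>f + g\<close>, whose supports may differ by cancellation.\<close>

lemma shift_eq_sum:
  assumes "finite A" "Poly_Mapping.keys f \<subseteq> A"
  shows "shift f = (\<Sum>e\<in>A.
    Poly_Mapping.single 0 (Poly_Mapping.single 0 (Poly_Mapping.lookup f e)) * shift_monomial e)"
  unfolding shift_def by (rule sum.mono_neutral_left) (use assms in \<open>auto simp: in_keys_iff\<close>)

lemma shift_0 [simp]: "shift 0 = 0"
  by (simp add: shift_def)

lemma shift_add: "shift (f + g) = shift f + shift g"
proof -
  let ?A = "Poly_Mapping.keys f \<union> Poly_Mapping.keys g"
  have "Poly_Mapping.keys (f + g) \<subseteq> ?A" by (rule keys_add)
  then show ?thesis
    by (simp add: shift_eq_sum[of ?A] lookup_add single_add distrib_right sum.distrib)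
qed

lemma shift_sum: "shift (\<Sum>i\<in>A. g i) = (\<Sum>i\<in>A. shift (g i))"
  by (induction A rule: infinite_finite_induct) (simp_all add: shift_add)

lemma shift_single:
  "shift (Poly_Mapping.single e c) = Poly_Mapping.single 0 (Poly_Mapping.single 0 c) * shift_monomial e"
  by (subst shift_eq_sum[of "{e}"]) auto

text \<open>By bilinearity it is enough to treat monomials, where this is
  \<open>shift_monomial_add\<close>.\<close>

lemma shift_mult: "shift (f * g) = shift f * shift g"
proof -
  have "shift (f * g) = (\<Sum>a\<in>Poly_Mapping.keys f. \<Sum>b\<in>Poly_Mapping.keys g.
     Poly_Mapping.single 0 (Poly_Mapping.single 0 (Poly_Mapping.lookup f a * Poly_Mapping.lookup g b))
       * shift_monomial (a + b))"
    by (subst poly_mapping_times_eq_sum) (simp add: shift_sum shift_single)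
  also have "\<dots> = (\<Sum>a\<in>Poly_Mapping.keys f. \<Sum>b\<in>Poly_Mapping.keys g.
     (Poly_Mapping.single 0 (Poly_Mapping.single 0 (Poly_Mapping.lookup f a)) * shift_monomial a)
     * (Poly_Mapping.single 0 (Poly_Mapping.single 0 (Poly_Mapping.lookup g b)) * shift_monomial b))"
  proof (intro sum.cong refl)
    fix a b
    have "Poly_Mapping.single 0 (Poly_Mapping.single 0 (Poly_Mapping.lookup f a * Poly_Mapping.lookup g b))
      = Poly_Mapping.single 0 (Poly_Mapping.single 0 (Poly_Mapping.lookup f a)) *
        (Poly_Mapping.single 0 (Poly_Mapping.single 0 (Poly_Mapping.lookup g b)) :: ('a, ('a, 'b) mpoly) mpoly)"
      by (simp add: mult_single)
    then show "Poly_Mapping.single 0 (Poly_Mapping.single 0 (Poly_Mapping.lookup f a * Poly_Mapping.lookup g b))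
       * shift_monomial (a + b) =
     (Poly_Mapping.single 0 (Poly_Mapping.single 0 (Poly_Mapping.lookup f a)) * shift_monomial a)
     * (Poly_Mapping.single 0 (Poly_Mapping.single 0 (Poly_Mapping.lookup g b))
          * (shift_monomial b :: ('a, ('a, 'b) mpoly) mpoly))"
      by (simp only: shift_monomial_add mult.assoc mult.commute mult.left_commute)
  qed
  also have "\<dots> = shift f * shift g" by (simp add: shift_def sum_product)
  finally show ?thesis .
qed

lemma lookup_shift_0: "Poly_Mapping.lookup (shift f) 0 = f"
proof -
  have "Poly_Mapping.lookup (shift f) 0
      = (\<Sum>e\<in>Poly_Mapping.keys f. Poly_Mapping.single e (Poly_Mapping.lookup f e))"
    by (simp add: shift_def lookup_sum lookup_single_0_times lookup_shift_monomial_0 mult_single)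
  then show ?thesis by (simp add: poly_mapping_sum_single)
qed

text \<open>Monomials of \<open>f\<close> of degree below |e| do not reach y^e, and those of degree
  |e| contribute only at their own exponent. So no x-variable is left.\<close>

lemma lookup_shift_top:
  assumes "\<And>a. a \<in> Poly_Mapping.keys f \<Longrightarrow> mon_degree a \<le> mon_degree e"
  shows "Poly_Mapping.lookup (shift f) e = Poly_Mapping.single 0 (Poly_Mapping.lookup f e)"
proof -
  have "Poly_Mapping.lookup (shift f) e = (\<Sum>a\<in>Poly_Mapping.keys f.
      Poly_Mapping.single 0 (Poly_Mapping.lookup f a) * (1 when e = a))"
    by (simp add: shift_def lookup_sum lookup_single_0_times lookup_shift_monomial_top assms)
  also have "\<dots> = (\<Sum>a\<in>Poly_Mapping.keys f.
      if a = e then Poly_Mapping.single 0 (Poly_Mapping.lookup f e) else 0)"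
    by (intro sum.cong) (auto simp: when_def)
  also have "\<dots> = Poly_Mapping.single 0 (Poly_Mapping.lookup f e)"
    by (simp add: in_keys_iff)
  finally show ?thesis .
qed

section \<open>Order of vanishing modulo an ideal\<close>

text \<open>For \<open>h = shift f\<close> the coefficients are the Hasse derivatives of
  \<open>f\<close>. These involve no division by factorials, so the argument works in every
  characteristic.\<close>

definition vanishes_to_order :: "'a::comm_ring_1 set \<Rightarrow> nat \<Rightarrow> ('n, 'a) mpoly set" where
  "vanishes_to_order P n = {h. \<forall>e. mon_degree e < n \<longrightarrow> Poly_Mapping.lookup h e \<in> P}"

lemma vanishes_to_order_add:
  assumes "ideal P type_ring" "g \<in> vanishes_to_order P n" "h \<in> vanishes_to_order P n"
  shows "g + h \<in> vanishes_to_order P n"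
  using assms by (auto simp: vanishes_to_order_def lookup_add ideal_type_ring_iff)

lemma ideal_sum:
  assumes "ideal P (type_ring :: 'a::comm_ring_1 ring)" "\<And>i. i \<in> A \<Longrightarrow> f i \<in> P"
  shows "sum f A \<in> P"
  using assms by (induction A rule: infinite_finite_induct) (auto simp: ideal_type_ring_iff)

text \<open>If |a| + |b| < n + m, then |a| < n or |b| < m, so one of the two coefficients lies in
  \<open>P\<close>.\<close>

lemma vanishes_to_order_mult:
  fixes g h :: "('n::finite, 'a::comm_ring_1) mpoly"
  assumes P: "ideal P type_ring" and g: "g \<in> vanishes_to_order P n" and h: "h \<in> vanishes_to_order P m"
  shows "g * h \<in> vanishes_to_order P (n + m)"
proof -
  have "Poly_Mapping.lookup (g * h) e \<in> P" if e: "mon_degree e < n + m" for e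
  proof -
    have "Poly_Mapping.lookup (Poly_Mapping.single (a + b)
        (Poly_Mapping.lookup g a * Poly_Mapping.lookup h b)) e \<in> P" for a b
    proof (cases "e = a + b")
      case True
      with e have "mon_degree a < n \<or> mon_degree b < m" by (auto simp: mon_degree_add)
      then have "Poly_Mapping.lookup g a \<in> P \<or> Poly_Mapping.lookup h b \<in> P"
        using g h by (auto simp: vanishes_to_order_def)
      with True show ?thesis using ideal_mult[OF P] by auto
    next
      case False
      with P show ?thesis by (auto simp: ideal_type_ring_iff lookup_single when_def)
    qed
    then show ?thesis
      by (subst poly_mapping_times_eq_sum) (auto simp: lookup_sum intro!: ideal_sum[OF P])
  qed
  then show ?thesis by (auto simp: vanishes_to_order_def)
qed

text \<open>The constant coefficient of \<open>shift b\<close> is \<open>b\<close>, so elements of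
  \<open>I \<subseteq> P\<close> vanish to order 1, and orders add under multiplication.\<close>

lemma shift_ideal_power_vanishes:
  fixes I P :: "('n::finite, 'k::comm_ring_1) mpoly set"
  assumes P: "ideal P type_ring" and "I \<subseteq> P" and "f \<in> ideal_power I m"
  shows "shift f \<in> vanishes_to_order P m"
proof -
  have "ideal_power I m \<subseteq> {f. shift f \<in> vanishes_to_order P m}"
  proof (rule ideal_power_subset_filtration)
    show "{f. shift f \<in> vanishes_to_order P 0} = UNIV" by (auto simp: vanishes_to_order_def)
    fix n a b
    show "a + b \<in> {f. shift f \<in> vanishes_to_order P n}"
      if "a \<in> {f. shift f \<in> vanishes_to_order P n}" "b \<in> {f. shift f \<in> vanishes_to_order P n}"
      using that vanishes_to_order_add[OF P] by (simp add: shift_add)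
    show "a * b \<in> {f. shift f \<in> vanishes_to_order P (Suc n)}"
      if "a \<in> {f. shift f \<in> vanishes_to_order P n}" "b \<in> I"
    proof -
      have "shift b \<in> vanishes_to_order P 1"
        using that \<open>I \<subseteq> P\<close> by (auto simp: vanishes_to_order_def lookup_shift_0)
      then show ?thesis using that vanishes_to_order_mult[OF P, of "shift a" n "shift b" 1]
        by (simp add: shift_mult)
    qed
  qed
  with assms(3) show ?thesis by blast
qed

text \<open>Split off the constant coefficient: \<open>g = c + g'\<close> with
  \<open>c \<notin> P\<close>. If \<open>h\<close> vanishes to order \<open>n < m\<close>, then
  \<open>g' * h\<close> vanishes to order \<open>n + 1\<close>, hence so does
  \<open>c * h = g * h - g' * h\<close>, and primality cancels \<open>c\<close>.\<close>

lemma vanishes_to_order_cancel: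
  fixes g h :: "('n::finite, 'a::comm_ring_1) mpoly"
  assumes P: "primeideal P type_ring" and g: "Poly_Mapping.lookup g 0 \<notin> P"
    and gh: "g * h \<in> vanishes_to_order P m"
  shows "h \<in> vanishes_to_order P m"
proof -
  have id: "ideal P type_ring" using P by (rule primeideal.axioms)
  define c where "c = Poly_Mapping.lookup g 0"
  define g' where "g' = g - Poly_Mapping.single 0 c"
  have g': "g' \<in> vanishes_to_order P 1"
    using id by (auto simp: vanishes_to_order_def g'_def c_def lookup_minus ideal_type_ring_iff)
  have "n \<le> m \<Longrightarrow> h \<in> vanishes_to_order P n" for n
  proof (induction n)
    case 0
    show ?case by (simp add: vanishes_to_order_def)
  next
    case (Suc n)
    then have "g' * h \<in> vanishes_to_order P (Suc n)"
      using vanishes_to_order_mult[OF id g', of h n] by simp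
    moreover have "g * h \<in> vanishes_to_order P (Suc n)"
      using gh Suc.prems by (auto simp: vanishes_to_order_def)
    moreover have "Poly_Mapping.single 0 c * h = g * h - g' * h"
      by (simp add: g'_def left_diff_distrib)
    ultimately have "c * Poly_Mapping.lookup h e \<in> P" if "mon_degree e < Suc n" for e
      using that ideal_diff[OF id, of "Poly_Mapping.lookup (g * h) e" "Poly_Mapping.lookup (g' * h) e"]
      by (simp add: vanishes_to_order_def flip: lookup_single_0_times lookup_minus)
    then have "Poly_Mapping.lookup h e \<in> P" if "mon_degree e < Suc n" for e
      using that g primeideal.I_prime[OF P, of c "Poly_Mapping.lookup h e"]
      by (auto simp: c_def ring_of_type_algebra_def)
    then show ?case by (simp add: vanishes_to_order_def)
  qed
  then show ?thesis by simp
qed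

lemma symbolic_power_degree_ge:
  fixes I :: "('n::{finite,linorder}, 'k::field) mpoly set"
  assumes I: "ideal I type_ring" and "I \<noteq> UNIV"
    and f: "f \<in> symbolic_power I m" "f \<noteq> 0" "homogeneous_of_degree d f"
  shows "m \<le> d"
proof (rule ccontr)
  assume "\<not> m \<le> d"
  have ne: "associated_primes I \<noteq> {}" by (rule associated_primes_nonempty) fact+
  then obtain P where P: "P \<in> associated_primes I" by blast
  then have prime: "primeideal P type_ring" by (simp add: associated_primes_def)
  then have id: "ideal P type_ring" by (rule primeideal.axioms)
  from P obtain g where "P = {h. h * g \<in> I}" by (auto simp: associated_primes_def)
  then have "I \<subseteq> P" using ideal_mult[OF I] by auto
  obtain s where s: "s \<notin> P" "s * f \<in> ideal_power I m"
    using f(1) mem_symbolic_power_iff[OF I ne] P by blast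
  have "shift f \<in> vanishes_to_order P m"
  proof (rule vanishes_to_order_cancel[OF prime])
    show "Poly_Mapping.lookup (shift s) 0 \<notin> P" using s by (simp add: lookup_shift_0)
    show "shift s * shift f \<in> vanishes_to_order P m"
      using shift_ideal_power_vanishes[OF id \<open>I \<subseteq> P\<close> s(2)] by (simp add: shift_mult)
  qed
  moreover obtain e where e: "e \<in> Poly_Mapping.keys f" using f(2) by (metis all_not_in_conv keys_eq_empty)
  moreover have deg: "mon_degree a = d" if "a \<in> Poly_Mapping.keys f" for a
    using that f(3) by (simp add: homogeneous_of_degree_def)
  \<comment> \<open>As \<open>f\<close> is a form of degree \<open>d\<close>, its Taylor coefficient
    at \<open>e\<close> is a constant; \<open>d < m\<close> puts it into \<open>P\<close>.\<close>
  ultimately have "Poly_Mapping.single 0 (Poly_Mapping.lookup f e) \<in> P"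
    using lookup_shift_top[of f e] \<open>\<not> m \<le> d\<close> unfolding vanishes_to_order_def
    by (metis (mono_tags, lifting) linorder_not_le mem_Collect_eq order_refl)
  \<comment> \<open>A nonzero constant is a unit, so \<open>P\<close> would be the whole ring,
    although \<open>s\<close> lies outside.\<close>
  then have "x * Poly_Mapping.single 0 (1 / Poly_Mapping.lookup f e)
      * Poly_Mapping.single 0 (Poly_Mapping.lookup f e) \<in> P" for x
    using id unfolding ideal_type_ring_iff by blast
  then have "x \<in> P" for x using e by (simp add: mult.assoc mult_single in_keys_iff)
  with s(1) show False by blast
qed

subsection \<open>Initial degrees and their limit\<close>

lemma alpha_le: "f \<in> J \<Longrightarrow> f \<noteq> 0 \<Longrightarrow> homogeneous_of_degree t f \<Longrightarrow> alpha J \<le> t"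
  unfolding alpha_def by (rule Least_le) blast

text \<open>\<open>LEAST\<close> has a meaningful value only if some nonzero form exists, which the
  given \<open>f\<close> ensures.\<close>

lemma alpha_attained:
  assumes "f \<in> J" "f \<noteq> 0" "homogeneous_of_degree t f"
  shows "\<exists>g\<in>J. g \<noteq> 0 \<and> homogeneous_of_degree (alpha J) g"
  unfolding alpha_def by (rule LeastI[of _ t]) (use assms in blast)

lemma homogeneous_of_degree_mult:
  fixes f g :: "('n::finite, 'k::semiring_0) mpoly"
  assumes "homogeneous_of_degree c f" "homogeneous_of_degree d g"
  shows "homogeneous_of_degree (c + d) (f * g)"
  using assms keys_mult[of f g] by (fastforce simp: homogeneous_of_degree_def mon_degree_add)

lemma homogeneous_of_degree_power:
  fixes f :: "('n::finite, 'k::comm_semiring_1) mpoly"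
  assumes "homogeneous_of_degree d f"
  shows "homogeneous_of_degree (m * d) (f ^ m)"
proof (induction m)
  case 0
  show ?case by (simp add: homogeneous_of_degree_def)
next
  case (Suc m)
  then show ?case using homogeneous_of_degree_mult[OF assms] by simp
qed

lemma lookup_homogeneous_component:
  "Poly_Mapping.lookup (homogeneous_component d f) e =
     (if mon_degree e = d then Poly_Mapping.lookup f e else 0)"
proof -
  have "Poly_Mapping.lookup (homogeneous_component d f) e =
      (\<Sum>a\<in>{a \<in> Poly_Mapping.keys f. mon_degree a = d}. if a = e then Poly_Mapping.lookup f e else 0)"
    unfolding homogeneous_component_def lookup_sum
    by (rule sum.cong) (auto simp: lookup_single when_def)
  also have "\<dots> = (if mon_degree e = d then Poly_Mapping.lookup f e else 0)"
    by (subst sum.delta) (auto simp: in_keys_iff)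
  finally show ?thesis .
qed

lemma homogeneous_of_degree_component: "homogeneous_of_degree d (homogeneous_component d f)"
  by (auto simp: homogeneous_of_degree_def in_keys_iff lookup_homogeneous_component split: if_splits)

lemma homogeneous_component_nonzero:
  "e \<in> Poly_Mapping.keys f \<Longrightarrow> homogeneous_component (mon_degree e) f \<noteq> 0"
  by (metis in_keys_iff lookup_homogeneous_component lookup_zero)

text \<open>The component of \<open>f\<close> in which \<open>e\<close> occurs is a nonzero form in
  \<open>I\<close>.\<close>

lemma alpha_le_mon_degree:
  assumes "homogeneous_ideal I" "f \<in> I" "e \<in> Poly_Mapping.keys f"
  shows "alpha I \<le> mon_degree e"
  using assms homogeneous_component_nonzero homogeneous_of_degree_component
  by (intro alpha_le[of "homogeneous_component (mon_degree e) f"]) (auto simp: homogeneous_ideal_def)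

lemma homogeneous_ideal_alpha_attained:
  assumes "homogeneous_ideal I" "I \<noteq> {0}"
  shows "\<exists>f\<in>I. f \<noteq> 0 \<and> homogeneous_of_degree (alpha I) f"
proof -
  have "0 \<in> I" using assms(1) by (auto simp: homogeneous_ideal_def ideal_type_ring_iff)
  with assms(2) obtain f where "f \<in> I" "f \<noteq> 0" by blast
  moreover from \<open>f \<noteq> 0\<close> obtain e where "e \<in> Poly_Mapping.keys f"
    by (metis all_not_in_conv keys_eq_empty)
  ultimately show ?thesis
    using assms(1) homogeneous_component_nonzero homogeneous_of_degree_component
    by (intro alpha_attained[of "homogeneous_component (mon_degree e) f"]) (auto simp: homogeneous_ideal_def)
qed

text \<open>Monomials of a product are products of monomials, so the degree bounds add up. Bounding
  all monomials avoids decomposing elements of the power into forms.\<close>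

lemma ideal_power_mon_degree_ge:
  fixes I :: "('n::finite, 'k::comm_ring_1) mpoly set"
  assumes "homogeneous_ideal I" "f \<in> ideal_power I r" "e \<in> Poly_Mapping.keys f"
  shows "r * alpha I \<le> mon_degree e"
proof -
  have "ideal_power I r \<subseteq> {f. \<forall>e\<in>Poly_Mapping.keys f. r * alpha I \<le> mon_degree e}"
  proof (rule ideal_power_subset_filtration)
    fix n and a b :: "('n, 'k) mpoly"
    show "a + b \<in> {f. \<forall>e\<in>Poly_Mapping.keys f. n * alpha I \<le> mon_degree e}"
      if "a \<in> {f. \<forall>e\<in>Poly_Mapping.keys f. n * alpha I \<le> mon_degree e}"
        "b \<in> {f. \<forall>e\<in>Poly_Mapping.keys f. n * alpha I \<le> mon_degree e}"
      using that keys_add[of a b] by blast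
    show "a * b \<in> {f. \<forall>e\<in>Poly_Mapping.keys f. Suc n * alpha I \<le> mon_degree e}"
      if a: "a \<in> {f. \<forall>e\<in>Poly_Mapping.keys f. n * alpha I \<le> mon_degree e}" and b: "b \<in> I"
    proof (rule CollectI, rule ballI)
      fix e assume "e \<in> Poly_Mapping.keys (a * b)"
      then obtain c d where "e = c + d" "c \<in> Poly_Mapping.keys a" "d \<in> Poly_Mapping.keys b"
        using keys_mult[of a b] by blast
      then show "Suc n * alpha I \<le> mon_degree e"
        using a alpha_le_mon_degree[OF assms(1) b, of d] by (fastforce simp: mon_degree_add)
    qed
  qed simp
  with assms show ?thesis by blast
qed

text \<open>The limit is the infimum of the quotients. For an index \<open>k\<close> with nearly
  minimal quotient, division with remainder n = q k + r gives a n \<le> q a k + a r, and the bounded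
  term a r disappears after division by n.\<close>

lemma fekete:
  fixes a :: "nat \<Rightarrow> real"
  assumes sub: "\<And>m n. a (m + n) \<le> a m + a n" and nonneg: "\<And>n. 0 \<le> a n"
  shows "\<exists>L. (\<lambda>n. a n / n) \<longlonglongrightarrow> L \<and> (\<forall>n\<ge>1. L \<le> a n / n)"
proof -
  define L where "L = (INF n\<in>{1..}. a n / n)"
  have bdd: "bdd_below ((\<lambda>n. a n / n) ` {1..})"
    using nonneg by (intro bdd_belowI2[of _ 0]) simp
  have low: "L \<le> a n / n" if "n \<ge> 1" for n
    unfolding L_def using that bdd by (intro cINF_lower) auto
  have "\<exists>N. \<forall>n\<ge>N. \<bar>a n / n - L\<bar> < \<epsilon>" if "\<epsilon> > 0" for \<epsilon>
  proof -
    obtain k where k: "k \<ge> 1" "a k / k < L + \<epsilon> / 2"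
      using cInf_lessD[of "(\<lambda>n. a n / n) ` {1..}" "L + \<epsilon> / 2"] \<open>\<epsilon> > 0\<close> by (auto simp: L_def)
    \<comment> \<open>As the terms are nonnegative, this sum bounds \<open>a r\<close> for every
      remainder \<open>r < k\<close>.\<close>
    define M where "M = (\<Sum>r<k. a r)"
    have mult: "a (q * k + r) \<le> q * a k + a r" for q r
    proof (induction q)
      case (Suc q)
      have "a (Suc q * k + r) \<le> a k + a (q * k + r)" using sub[of k "q * k + r"] by (simp add: ac_simps)
      with Suc show ?case by (simp add: algebra_simps)
    qed simp
    have upper: "a n / n < L + \<epsilon>" if n: "n \<ge> 1" "n > 2 * M / \<epsilon>" for n
    proof -
      have "a (n mod k) \<le> M"
        unfolding M_def using k nonneg by (intro member_le_sum) auto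
      then have "a n \<le> (n div k) * a k + M" using mult[of "n div k" "n mod k"] by simp
      also have "(n div k) * a k = (n div k * k) * (a k / k)" using k by simp
      also have "\<dots> \<le> n * (a k / k)"
        using nonneg[of k] by (intro mult_right_mono) (auto simp flip: of_nat_mult)
      finally have "a n / n \<le> a k / k + M / n" using n by (simp add: field_simps)
      moreover have "M / n < \<epsilon> / 2" using n \<open>\<epsilon> > 0\<close> by (simp add: field_simps)
      ultimately show ?thesis using k(2) by linarith
    qed
    obtain N where N: "2 * M / \<epsilon> < real N" using reals_Archimedean2 by blast
    have "\<bar>a n / n - L\<bar> < \<epsilon>" if "n \<ge> max 1 N" for n
    proof -
      have "2 * M / \<epsilon> < real n" using N that by simp
      with upper[of n] low[of n] that \<open>\<epsilon> > 0\<close> show ?thesis by (simp add: abs_less_iff)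
    qed
    then show ?thesis by blast
  qed
  then have "(\<lambda>n. a n / n) \<longlonglongrightarrow> L" by (auto intro!: LIMSEQ_I)
  with low show ?thesis by blast
qed

section \<open>Comparison of initial degrees, their limit and the resurgence\<close>

theorem lemma2p3p2:
  fixes I :: "('n::{finite,linorder}, 'k::alg_closed_field) mpoly set"
    and N :: nat
  assumes "N \<ge> 1" and "CARD('n) = N + 1"
    and "homogeneous_ideal I" and "I \<noteq> {0}" and "I \<noteq> UNIV"
  shows "gamma I \<ge> 1 \<and>
    (\<forall>m r. m \<ge> 1 \<longrightarrow> r \<ge> 1 \<longrightarrow> r * alpha I > alpha (symbolic_power I m) \<longrightarrow>
       \<not> symbolic_power I m \<subseteq> ideal_power I r) \<and>
    (\<forall>m r. m \<ge> 1 \<longrightarrow> r \<ge> 1 \<longrightarrow> real m / real r < real (alpha I) / gamma I \<longrightarrow>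
       (\<forall>\<^sub>F t in sequentially. \<not> symbolic_power I (m * t) \<subseteq> ideal_power I (r * t))) \<and>
    1 \<le> real (alpha I) / gamma I \<and>
    ereal (real (alpha I) / gamma I) \<le> resurgence I"
proof -
  have I: "ideal I type_ring" using assms(3) by (simp add: homogeneous_ideal_def)
  have ne: "associated_primes I \<noteq> {}" by (rule associated_primes_nonempty[OF I assms(5)])
  define a where "a m = alpha (symbolic_power I m)" for m
  obtain f where f: "f \<in> I" "f \<noteq> 0" "homogeneous_of_degree (alpha I) f"
    using homogeneous_ideal_alpha_attained assms by blast
  \<comment> \<open>Powers of a form of least degree in \<open>I\<close> witness that every symbolic
    power contains a nonzero form.\<close>
  have fpow: "f ^ m \<in> symbolic_power I m" "f ^ m \<noteq> 0" "homogeneous_of_degree (m * alpha I) (f ^ m)" for m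
    using f power_mem_ideal_power[OF f(1), of m] ideal_power_subset_symbolic_power[OF I ne, of m]
      homogeneous_of_degree_power by auto
  have attained: "\<exists>g\<in>symbolic_power I m. g \<noteq> 0 \<and> homogeneous_of_degree (a m) g" for m
    unfolding a_def by (rule alpha_attained) (rule fpow)+
  have ge: "m \<le> a m" for m
    using attained symbolic_power_degree_ge[OF I assms(5)] by blast
  have sub: "a (m + n) \<le> a m + a n" for m n
  proof -
    obtain g h where "g \<in> symbolic_power I m" "g \<noteq> 0" "homogeneous_of_degree (a m) g"
        "h \<in> symbolic_power I n" "h \<noteq> 0" "homogeneous_of_degree (a n) h"
      using attained by meson
    then have "g * h \<in> symbolic_power I (m + n)" "g * h \<noteq> 0" "homogeneous_of_degree (a m + a n) (g * h)"
      using symbolic_power_mult[OF I ne] homogeneous_of_degree_mult by auto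
    then show ?thesis unfolding a_def by (rule alpha_le)
  qed
  obtain L where L: "(\<lambda>n. real (a n) / real n) \<longlonglongrightarrow> L" "\<And>n. n \<ge> 1 \<Longrightarrow> L \<le> real (a n) / real n"
    using fekete[of "\<lambda>n. real (a n)"] sub by (auto simp flip: of_nat_add)
  have gamma: "gamma I = L" unfolding gamma_def a_def[symmetric] by (rule limI[OF L(1)])
  \<comment> \<open>The bound \<open>m \<le> a m\<close> is used from index 1 on, since the quotient
    at 0 is 0 by convention.\<close>
  have L1: "L \<ge> 1"
    using ge by (intro LIMSEQ_le_const[OF L(1)] exI[of _ 1]) (auto simp: field_simps)
  have "L \<le> real (alpha I)"
    using L(2)[of 1] alpha_le[OF fpow(1)[of 1] fpow(2)[of 1] fpow(3)[of 1]] by (simp add: a_def)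
  then have quot: "1 \<le> real (alpha I) / L" using L1 by simp
  \<comment> \<open>Claim (a): a form of degree \<open>a m\<close> in the symbolic power has
    monomials of too small a degree for the \<open>r\<close>-th power.\<close>
  have not_sub: "\<not> symbolic_power I m \<subseteq> ideal_power I r" if less: "a m < r * alpha I" for m r
  proof
    assume sub: "symbolic_power I m \<subseteq> ideal_power I r"
    obtain g where g: "g \<in> symbolic_power I m" "g \<noteq> 0" "homogeneous_of_degree (a m) g"
      using attained by blast
    then obtain e where e: "e \<in> Poly_Mapping.keys g" by (metis all_not_in_conv keys_eq_empty)
    then have "r * alpha I \<le> mon_degree e"
      using ideal_power_mon_degree_ge[OF assms(3)] sub g by blast
    with less e g(3) show False by (auto simp: homogeneous_of_degree_def)
  qed
  have asymptotic: "\<forall>\<^sub>F t in sequentially. \<not> symbolic_power I (m * t) \<subseteq> ideal_power I (r * t)"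
    if m: "m \<ge> 1" and r: "r \<ge> 1" and less: "real m / real r < real (alpha I) / L" for m r
  proof -
    \<comment> \<open>Since \<open>L\<close> is positive, the hypothesis on m/r takes this form. The
      quotients along multiples of \<open>m\<close> tend to \<open>L\<close>, so they eventually
      fall below the bound, and (a) applies to \<open>m * t\<close> and
      \<open>r * t\<close>.\<close>
    have "L < real (r * alpha I) / real m" using less m r L1 by (simp add: field_simps)
    moreover have "filterlim (\<lambda>t. m * t) sequentially sequentially"
      using m by (intro mult_nat_left_at_top) simp
    then have "(\<lambda>t. real (a (m * t)) / real (m * t)) \<longlonglongrightarrow> L" by (rule filterlim_compose[OF L(1)])
    ultimately have "\<forall>\<^sub>F t in sequentially. real (a (m * t)) / real (m * t) < real (r * alpha I) / real m"
      by (intro order_tendstoD)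
    then show ?thesis
      using eventually_gt_at_top[of 0]
    proof eventually_elim
      case (elim t)
      then have "real (a (m * t)) < real (r * alpha I) * real t"
        using m by (simp add: field_simps)
      then have "real (a (m * t)) < real ((r * t) * alpha I)" by (simp add: ac_simps)
      then have "a (m * t) < (r * t) * alpha I" by (simp only: of_nat_less_iff)
      then show ?case by (rule not_sub)
    qed
  qed
  \<comment> \<open>Every positive rational m/r below the bound is a ratio in the supremum: (b)
    provides some \<open>t\<close>, and scaling by \<open>t\<close> leaves the ratio
    unchanged.\<close>
  have "ereal (real (alpha I) / L) \<le> resurgence I"
  proof (rule dense_le)
    fix y assume y: "y < ereal (real (alpha I) / L)"
    \<comment> \<open>\<open>y\<close> may be negative or -\<infinity>. Truncating at 0 yields a
      real \<open>z \<ge> 0\<close>, which forces \<open>x > 0\<close> and hence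
      \<open>m \<noteq> 0\<close>, as membership in the set of ratios demands.\<close>
    have "max y 0 < ereal (real (alpha I) / L)" using y quot by auto
    then obtain z where z: "max y 0 = ereal z" "0 \<le> z" "z < real (alpha I) / L"
      by (cases "max y 0") (auto simp: max_def split: if_splits)
    obtain x where x: "x \<in> \<rat>" "z < x" "x < real (alpha I) / L"
      using Rats_dense_in_real[OF z(3)] by blast
    obtain m r where mr: "r \<noteq> 0" "\<bar>x\<bar> = real m / real r"
      using Rats_abs_nat_div_natE[OF x(1)] by metis
    have xmr: "x = real m / real r" "m \<noteq> 0" using mr x z by (auto intro: ccontr)
    have "\<forall>\<^sub>F t in sequentially. \<not> symbolic_power I (m * t) \<subseteq> ideal_power I (r * t)"
      using x mr xmr by (intro asymptotic) auto
    then have "\<forall>\<^sub>F t in sequentially. \<not> symbolic_power I (m * t) \<subseteq> ideal_power I (r * t) \<and> t > 0"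
      using eventually_gt_at_top[of 0] by (rule eventually_conj)
    then obtain t where t: "\<not> symbolic_power I (m * t) \<subseteq> ideal_power I (r * t)" "t > 0"
      using eventually_happens'[OF sequentially_bot] by blast
    have "ereal (real (m * t) / real (r * t)) \<le> resurgence I"
      unfolding resurgence_def
    proof (rule Sup_upper, rule CollectI, intro exI conjI)
      show "ereal (real (m * t) / real (r * t)) = ereal (real (m * t) / real (r * t))" ..
      show "1 \<le> m * t" "1 \<le> r * t" using t(2) mr(1) xmr(2) by simp_all
      show "\<not> symbolic_power I (m * t) \<subseteq> ideal_power I (r * t)" by (rule t(1))
    qed
    moreover have "real (m * t) / real (r * t) = x" using t xmr by simp
    moreover have "y \<le> ereal z" by (metis max.cobounded1 z(1))
    moreover have "ereal z \<le> ereal x" using x by simp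
    ultimately show "y \<le> resurgence I" by (metis order_trans)
  qed
  with L1 quot not_sub asymptotic show ?thesis unfolding gamma a_def by blast
qed

end
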